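(* Let $1\le p\le\infty$, let $q$ be the conjugate exponent of $p$ ($1/p+1/q=1$), and let $s=\max\{0,\,1-2/q\}$. Let $\mathbf{A}$ be a fixed real $m\times n$ matrix, and let $\mathbf{X}=[X_{jk}]$ be a random $m\times n$ real matrix with independent entries for which $\mathbb{E}\mathbf{X}=\mathbf{A}$. Assume that, for some constant $D>0$, $|X_{jk}|\le D/2$ almost surely for all $j,k$. Then, for all $t>0$, \[ \mathbb{P}\left(\|\mathbf{A}-\mathbf{X}\|_{\infty\to p}>\mathbb{E}\|\mathbf{A}-\mathbf{X}\|_{\infty\to p}+t\right)\le e^{-t^2/(4D^2nm^s)}. \]
   Context: For a real $m\times n$ matrix $\mathbf{B}$, $\|\mathbf{B}\|_{\infty\to p}=\max_{\mathbf{u}\ne\mathbf{0}}\|\mathbf{B}\mathbf{u}\|_p/\|\mathbf{u}\|_\infty$ is the operator norm from $\ell_\infty^n$ to $\ell_p^m$. The expectation of a random matrix is taken entrywise. When $q=\infty$, $2/q$ is read as $0$. *)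

theory Defs
  imports "HOL-Probability.Probability"
begin

definition lp_norm :: "ennreal \<Rightarrow> real ^ 'n \<Rightarrow> real" where
  "lp_norm p x =
    (if p = \<infinity> then infnorm x
     else (\<Sum>i\<in>UNIV. \<bar>x $ i\<bar> powr enn2real p) powr (1 / enn2real p))"

text \<open>For \<open>p \<ge> 1\<close> the supremum below is a maximum; see \<open>op_norm_inf_attained\<close>.\<close>

definition op_norm_inf :: "ennreal \<Rightarrow> real ^ 'n ^ 'm \<Rightarrow> real" where
  "op_norm_inf p B = (SUP u\<in>{u. u \<noteq> 0}. lp_norm p (B *v u) / lp_norm \<infinity> u)"

definition entrywise_expectation :: "'w measure \<Rightarrow> ('w \<Rightarrow> real ^ 'n ^ 'm) \<Rightarrow> real ^ 'n ^ 'm" where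
  "entrywise_expectation M X = (\<chi> j k. integral\<^sup>L M (\<lambda>\<omega>. X \<omega> $ j $ k))"

lemma enn2real_pos_of_ge_1:
  fixes p :: ennreal
  assumes "1 \<le> p" "p \<noteq> \<infinity>"
  shows "0 < enn2real p"
proof -
  have "0 < p" by (rule less_le_trans[OF _ assms(1)]) simp
  moreover have "p < top" using assms(2) by (simp add: less_top)
  ultimately show ?thesis by (simp add: enn2real_positive_iff)
qed

lemma lp_norm_scale:
  fixes x :: "real ^ 'n"
  assumes "p \<ge> 1"
  shows "lp_norm p (c *\<^sub>R x) = \<bar>c\<bar> * lp_norm p x"
proof (cases "p = \<infinity>")
  case True
  then show ?thesis by (simp add: lp_norm_def infnorm_mul)
next
  case False
  define r where "r = enn2real p"
  have r: "r > 0"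
    unfolding r_def by (rule enn2real_pos_of_ge_1[OF assms False])
  let ?S = "\<lambda>x :: real ^ 'n. \<Sum>i\<in>UNIV. \<bar>x $ i\<bar> powr r"
  have "?S (c *\<^sub>R x) = \<bar>c\<bar> powr r * ?S x"
    by (simp add: abs_mult powr_mult sum_distrib_left)
  then have "?S (c *\<^sub>R x) powr (1 / r) = (\<bar>c\<bar> powr r * ?S x) powr (1 / r)"
    by (rule arg_cong)
  also have "\<dots> = (\<bar>c\<bar> powr r) powr (1 / r) * ?S x powr (1 / r)"
    by (rule powr_mult)
  also have "(\<bar>c\<bar> powr r) powr (1 / r) = \<bar>c\<bar>"
    using r by (simp add: powr_powr)
  finally show ?thesis
    unfolding lp_norm_def if_not_P[OF False] r_def .
qed

lemma continuous_on_lp_norm: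
  assumes "p \<ge> 1"
  shows "continuous_on S (lp_norm p :: real ^ 'n \<Rightarrow> real)"
proof (cases "p = \<infinity>")
  case True
  have "continuous_on S (\<lambda>x :: real ^ 'n. infnorm x)"
    by (intro continuous_intros)
  then show ?thesis
    unfolding lp_norm_def[abs_def] if_P[OF True] .
next
  case False
  define r where "r = enn2real p"
  have r: "r > 0"
    unfolding r_def by (rule enn2real_pos_of_ge_1[OF assms False])
  have "continuous_on S (\<lambda>x :: real ^ 'n. (\<Sum>i\<in>UNIV. \<bar>x $ i\<bar> powr r) powr (1 / r))"
    using r by (intro continuous_on_powr' continuous_intros ballI conjI impI sum_nonneg) auto
  then show ?thesis
    unfolding lp_norm_def[abs_def] if_not_P[OF False] r_def .
qed

lemma op_norm_inf_attained:
  fixes B :: "real ^ 'n ^ 'm"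
  assumes "p \<ge> 1"
  shows "\<exists>u. u \<noteq> 0 \<and> op_norm_inf p B = lp_norm p (B *v u) / lp_norm \<infinity> u"
    and "u \<noteq> 0 \<Longrightarrow> lp_norm p (B *v u) / lp_norm \<infinity> u \<le> op_norm_inf p B"
proof -
  let ?f = "\<lambda>u. lp_norm p (B *v u) / lp_norm \<infinity> u"
  have "continuous_on (sphere 0 1) ?f"
  proof (rule continuous_on_divide)
    show "continuous_on (sphere 0 1) (\<lambda>u. lp_norm p (B *v u))"
      by (rule continuous_on_compose2[OF continuous_on_lp_norm[OF assms, of UNIV]
            matrix_vector_mult_linear_continuous_on]) simp
    show "continuous_on (sphere 0 1) (lp_norm \<infinity> :: real ^ 'n \<Rightarrow> real)"
      by (rule continuous_on_lp_norm) simp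
    show "\<forall>u\<in>sphere 0 1. lp_norm \<infinity> (u :: real ^ 'n) \<noteq> 0"
      by (auto simp: lp_norm_def infnorm_eq_0)
  qed
  moreover have "sphere 0 1 \<noteq> ({} :: (real ^ 'n) set)"
    by simp
  ultimately have "\<exists>v\<in>sphere 0 1. \<forall>u\<in>sphere 0 1. ?f u \<le> ?f v"
    by (intro continuous_attains_sup compact_sphere)
  then obtain v where v: "v \<in> sphere 0 1" "\<forall>u\<in>sphere 0 1. ?f u \<le> ?f v"
    by (elim bexE)
  have le: "?f u \<le> ?f v" if "u \<noteq> 0" for u
  proof -
    have "?f (inverse (norm u) *\<^sub>R u) = ?f u"
      using that assms by (simp add: lp_norm_scale matrix_vector_mult_scaleR)
    moreover have "?f (inverse (norm u) *\<^sub>R u) \<le> ?f v"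
      using that by (intro v(2)[rule_format]) simp
    ultimately show ?thesis by simp
  qed
  have v0: "v \<noteq> 0" using v(1) by auto
  have eq: "op_norm_inf p B = ?f v"
    unfolding op_norm_inf_def using v0 le by (intro cSup_eq_maximum) auto
  show "\<exists>u. u \<noteq> 0 \<and> op_norm_inf p B = ?f u" using eq v0 by blast
  show "?f u \<le> op_norm_inf p B" if "u \<noteq> 0" using le[OF that] eq by simp
qed

end

theory Submission
  imports Defs
begin

text \<open>
  The function \<open>X \<mapsto> \<parallel>A - X\<parallel>\<close> is convex, and since
  \<open>\<parallel>B u\<parallel>\<^sub>p \<le> m\<^bsup>s/2\<^esup> \<parallel>B u\<parallel>\<^sub>2\<close> and \<open>\<parallel>u\<parallel>\<^sub>2 \<le> \<surd>n \<parallel>u\<parallel>\<^sub>\<infinity>\<close>, it is Lipschitz with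
  constant \<open>K = \<surd>(n m\<^sup>s)\<close> for the Frobenius norm. So it suffices to bound the upper tail of a
  convex \<open>K\<close>-Lipschitz function of independent variables taking values in an interval of length \<open>D\<close>.
  This follows from Maurey's property \<open>\<tau>\<close>: writing \<open>Q f\<close> for the infimal convolution of \<open>f\<close> with
  \<open>\<parallel>z\<parallel>\<^sup>2 / (4 D\<^sup>2)\<close>, every convex \<open>f\<close> satisfies \<open>E (exp (Q f)) * E (exp (- f)) \<le> 1\<close>. In one
  dimension this is a consequence of moving from \<open>y\<close> towards the minimiser of \<open>f\<close> on the interval,
  and it tensorises. Applied to \<open>\<lambda> f\<close>, for which
  \<open>Q (\<lambda> f) \<ge> \<lambda> f - \<lambda>\<^sup>2 K\<^sup>2 D\<^sup>2\<close>, together with Jensen's inequality for \<open>E (exp (- \<lambda> f))\<close>, it gives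
  \<open>E (exp (\<lambda> (f - E f))) \<le> exp (\<lambda>\<^sup>2 K\<^sup>2 D\<^sup>2)\<close>, and one concludes by Markov's inequality.
\<close>

section \<open>Infimal convolution of convex Lipschitz functions\<close>

text \<open>Besides regularity, the bound forces \<open>f\<close> to depend only on the coordinates
  in \<open>J\<close> (\<open>lip_on_cong\<close>), so a function on a finite product can be kept as
  a total function on \<open>'i \<Rightarrow> real\<close>. It provides finiteness of infima,
  measurability and integrability; the constant in the tail bound comes from the Euclidean Lipschitz
  hypothesis of \<open>convex_concentration\<close>.\<close>

definition lip_on :: "'i set \<Rightarrow> real \<Rightarrow> (('i \<Rightarrow> real) \<Rightarrow> real) \<Rightarrow> bool" where
  "lip_on J L f \<longleftrightarrow> (\<forall>x y. \<bar>f x - f y\<bar> \<le> L * (\<Sum>i\<in>J. \<bar>x i - y i\<bar>))"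

definition convex_fun :: "(('i \<Rightarrow> real) \<Rightarrow> real) \<Rightarrow> bool" where
  "convex_fun f \<longleftrightarrow> (\<forall>x y \<theta>. 0 \<le> \<theta> \<longrightarrow> \<theta> \<le> 1 \<longrightarrow>
     f (\<lambda>i. (1 - \<theta>) * x i + \<theta> * y i) \<le> (1 - \<theta>) * f x + \<theta> * f y)"

text \<open>The shifts \<open>z\<close> are supported on \<open>I\<close>, so \<open>infconv k {i} f\<close> convolves in one coordinate only.\<close>

definition infconv :: "real \<Rightarrow> 'i set \<Rightarrow> (('i \<Rightarrow> real) \<Rightarrow> real) \<Rightarrow> ('i \<Rightarrow> real) \<Rightarrow> real" where
  "infconv k I f x =
     (INF z\<in>{z. \<forall>i. i \<notin> I \<longrightarrow> z i = 0}. f (\<lambda>i. x i - z i) + k * (\<Sum>i\<in>I. (z i)\<^sup>2))"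

lemma lip_onD: "lip_on J L f \<Longrightarrow> \<bar>f x - f y\<bar> \<le> L * (\<Sum>i\<in>J. \<bar>x i - y i\<bar>)"
  by (simp add: lip_on_def)

lemma lip_on_cong:
  assumes "lip_on J L f" "\<And>i. i \<in> J \<Longrightarrow> x i = y i"
  shows "f x = f y"
  using lip_onD[OF assms(1), of x y] assms(2) by simp

lemma lip_on_uminus: "lip_on J L f \<Longrightarrow> lip_on J L (\<lambda>x. - f x)"
  unfolding lip_on_def by (metis abs_minus_commute minus_diff_minus abs_minus_cancel)

lemma lip_on_cmult:
  assumes "lip_on J L f"
  shows "lip_on J (\<bar>c\<bar> * L) (\<lambda>x. c * f x)"
  unfolding lip_on_def
proof (intro allI)
  fix x y
  have "\<bar>c * f x - c * f y\<bar> = \<bar>c\<bar> * \<bar>f x - f y\<bar>"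
    by (simp add: abs_mult flip: right_diff_distrib)
  also have "\<dots> \<le> \<bar>c\<bar> * (L * (\<Sum>i\<in>J. \<bar>x i - y i\<bar>))"
    by (intro mult_left_mono lip_onD[OF assms]) simp
  finally show "\<bar>c * f x - c * f y\<bar> \<le> \<bar>c\<bar> * L * (\<Sum>i\<in>J. \<bar>x i - y i\<bar>)"
    by (simp add: mult.assoc)
qed

lemma convex_funD:
  "convex_fun f \<Longrightarrow> 0 \<le> \<theta> \<Longrightarrow> \<theta> \<le> 1 \<Longrightarrow>
     f (\<lambda>i. (1 - \<theta>) * x i + \<theta> * y i) \<le> (1 - \<theta>) * f x + \<theta> * f y"
  by (simp add: convex_fun_def)

lemma convex_fun_cmult:
  assumes "convex_fun f" "0 \<le> c"
  shows "convex_fun (\<lambda>x. c * f x)"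
  unfolding convex_fun_def
proof (intro allI impI)
  fix x y and \<theta> :: real assume "0 \<le> \<theta>" "\<theta> \<le> 1"
  from mult_left_mono[OF convex_funD[OF assms(1) this] assms(2)]
  show "c * f (\<lambda>i. (1 - \<theta>) * x i + \<theta> * y i) \<le> (1 - \<theta>) * (c * f x) + \<theta> * (c * f y)"
    by (simp add: algebra_simps)
qed

text \<open>In each coordinate the quadratic cost absorbs the linear loss of \<open>f\<close>: the
  square of \<open>2 * k * \<bar>z i\<bar> - L\<close> is nonnegative. Hence the infimum defining
  \<open>infconv\<close> is over a set bounded below.\<close>

lemma infconv_lower_bound:
  assumes "lip_on J L f" "finite J" "I \<subseteq> J" "k > 0" "\<And>i. i \<notin> I \<Longrightarrow> z i = 0"
  shows "f x - card I * (L\<^sup>2 / (4 * k)) \<le> f (\<lambda>i. x i - z i) + k * (\<Sum>i\<in>I. (z i)\<^sup>2)"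
proof -
  have "f x - f (\<lambda>i. x i - z i) \<le> L * (\<Sum>i\<in>J. \<bar>z i\<bar>)"
    using lip_onD[OF assms(1), of x "\<lambda>i. x i - z i"] by simp
  also have "(\<Sum>i\<in>J. \<bar>z i\<bar>) = (\<Sum>i\<in>I. \<bar>z i\<bar>)"
    by (rule sum.mono_neutral_right) (use assms in auto)
  also have "L * (\<Sum>i\<in>I. \<bar>z i\<bar>) \<le> (\<Sum>i\<in>I. k * (z i)\<^sup>2 + L\<^sup>2 / (4 * k))"
    unfolding sum_distrib_left
  proof (rule sum_mono)
    fix i
    have "0 \<le> (2 * k * \<bar>z i\<bar> - L)\<^sup>2" by simp
    then have "4 * k * (L * \<bar>z i\<bar>) \<le> 4 * k * (k * (z i)\<^sup>2) + L\<^sup>2"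
      by (simp add: power2_diff power_mult_distrib power2_eq_square algebra_simps)
    then have "4 * k * (L * \<bar>z i\<bar>) \<le> 4 * k * (k * (z i)\<^sup>2 + L\<^sup>2 / (4 * k))"
      using assms(4) by (simp add: distrib_left)
    then show "L * \<bar>z i\<bar> \<le> k * (z i)\<^sup>2 + L\<^sup>2 / (4 * k)"
      using assms(4) by (subst (asm) mult_le_cancel_left_pos) auto
  qed
  finally show ?thesis by (simp add: sum.distrib sum_distrib_left)
qed

lemma infconv_le:
  assumes "lip_on J L f" "finite J" "I \<subseteq> J" "k > 0" "\<And>i. i \<notin> I \<Longrightarrow> z i = 0"
  shows "infconv k I f x \<le> f (\<lambda>i. x i - z i) + k * (\<Sum>i\<in>I. (z i)\<^sup>2)"
  unfolding infconv_def
proof (rule cINF_lower)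
  show "bdd_below ((\<lambda>z. f (\<lambda>i. x i - z i) + k * (\<Sum>i\<in>I. (z i)\<^sup>2)) ` {z. \<forall>i. i \<notin> I \<longrightarrow> z i = 0})"
    by (rule bdd_belowI2[where m = "f x - card I * (L\<^sup>2 / (4 * k))"])
      (use infconv_lower_bound[OF assms(1-4)] in auto)
qed (use assms(5) in auto)

lemma le_infconv:
  assumes "\<And>z. (\<And>i. i \<notin> I \<Longrightarrow> z i = 0) \<Longrightarrow> c \<le> f (\<lambda>i. x i - z i) + k * (\<Sum>i\<in>I. (z i)\<^sup>2)"
  shows "c \<le> infconv k I f x"
  unfolding infconv_def by (rule cINF_greatest) (use assms in auto)

text \<open>An infimum of functions with a common Lipschitz constant keeps that constant: the same
  shift \<open>z\<close> is tried at \<open>x\<close> and at \<open>y\<close>.\<close>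

lemma lip_on_infconv:
  assumes "lip_on J L f" "finite J" "I \<subseteq> J" "k > 0"
  shows "lip_on J L (infconv k I f)"
proof -
  have le: "infconv k I f x - L * (\<Sum>i\<in>J. \<bar>x i - y i\<bar>) \<le> infconv k I f y" for x y
  proof (rule le_infconv)
    fix z assume z: "\<And>i. i \<notin> I \<Longrightarrow> z i = (0::real)"
    have "infconv k I f x \<le> f (\<lambda>i. x i - z i) + k * (\<Sum>i\<in>I. (z i)\<^sup>2)"
      by (rule infconv_le[OF assms z])
    moreover have "f (\<lambda>i. x i - z i) - f (\<lambda>i. y i - z i) \<le> L * (\<Sum>i\<in>J. \<bar>x i - y i\<bar>)"
      using lip_onD[OF assms(1), of "\<lambda>i. x i - z i" "\<lambda>i. y i - z i"] by simp
    ultimately show "infconv k I f x - L * (\<Sum>i\<in>J. \<bar>x i - y i\<bar>)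
        \<le> f (\<lambda>i. y i - z i) + k * (\<Sum>i\<in>I. (z i)\<^sup>2)" by simp
  qed
  show ?thesis
    unfolding lip_on_def
  proof (intro allI)
    fix x y
    show "\<bar>infconv k I f x - infconv k I f y\<bar> \<le> L * (\<Sum>i\<in>J. \<bar>x i - y i\<bar>)"
      using le[of x y] le[of y x] by (simp add: abs_minus_commute abs_le_iff)
  qed
qed

lemma square_convex_comb:
  fixes a b \<theta> :: real
  assumes "0 \<le> \<theta>" "\<theta> \<le> 1"
  shows "((1 - \<theta>) * a + \<theta> * b)\<^sup>2 \<le> (1 - \<theta>) * a\<^sup>2 + \<theta> * b\<^sup>2"
proof -
  have "(1 - \<theta>) * a\<^sup>2 + \<theta> * b\<^sup>2 - ((1 - \<theta>) * a + \<theta> * b)\<^sup>2 = \<theta> * (1 - \<theta>) * (a - b)\<^sup>2"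
    by (simp add: power2_eq_square algebra_simps)
  moreover have "0 \<le> \<theta> * (1 - \<theta>) * (a - b)\<^sup>2" using assms by simp
  ultimately show ?thesis by linarith
qed

text \<open>The function being minimised is jointly convex in the point and the shift, and partial
  minimisation preserves convexity. Shifts that are optimal up to \<open>e\<close> stand in for
  minimisers.\<close>

lemma convex_fun_infconv:
  assumes f: "lip_on J L f" "finite J" "I \<subseteq> J" "k > 0" and cv: "convex_fun f"
  shows "convex_fun (infconv k I f)"
  unfolding convex_fun_def
proof (intro allI impI)
  fix x y and \<theta> :: real assume t: "0 \<le> \<theta>" "\<theta> \<le> 1"
  let ?Q = "infconv k I f"
  have approx: "\<exists>z. (\<forall>i. i \<notin> I \<longrightarrow> z i = 0) \<and> f (\<lambda>i. x i - z i) + k * (\<Sum>i\<in>I. (z i)\<^sup>2) < ?Q x + e"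
    if "e > 0" for e x
  proof (rule ccontr)
    assume neg: "\<not> ?thesis"
    have "?Q x + e \<le> ?Q x"
    proof (rule le_infconv)
      fix z assume "\<And>i. i \<notin> I \<Longrightarrow> z i = (0::real)"
      with neg show "?Q x + e \<le> f (\<lambda>i. x i - z i) + k * (\<Sum>i\<in>I. (z i)\<^sup>2)"
        by (meson not_less)
    qed
    with that show False by simp
  qed
  show "?Q (\<lambda>i. (1 - \<theta>) * x i + \<theta> * y i) \<le> (1 - \<theta>) * ?Q x + \<theta> * ?Q y"
  proof (rule field_le_epsilon)
    fix e :: real assume e: "e > 0"
    obtain z where z: "\<And>i. i \<notin> I \<Longrightarrow> z i = 0"
        "f (\<lambda>i. x i - z i) + k * (\<Sum>i\<in>I. (z i)\<^sup>2) < ?Q x + e"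
      using approx[OF e, of x] by blast
    obtain w where w: "\<And>i. i \<notin> I \<Longrightarrow> w i = 0"
        "f (\<lambda>i. y i - w i) + k * (\<Sum>i\<in>I. (w i)\<^sup>2) < ?Q y + e"
      using approx[OF e, of y] by blast
    \<comment> \<open>The near-optimal shifts are combined with the same weights as \<open>x\<close>
      and \<open>y\<close>, so that the shifted point is the combination of \<open>x - z\<close> and
      \<open>y - w\<close>.\<close>
    let ?v = "\<lambda>i. (1 - \<theta>) * z i + \<theta> * w i"
    have "?Q (\<lambda>i. (1 - \<theta>) * x i + \<theta> * y i)
        \<le> f (\<lambda>i. (1 - \<theta>) * x i + \<theta> * y i - ?v i) + k * (\<Sum>i\<in>I. (?v i)\<^sup>2)"
      by (rule infconv_le[OF f]) (simp add: z w)
    also have "(\<lambda>i. (1 - \<theta>) * x i + \<theta> * y i - ?v i)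
        = (\<lambda>i. (1 - \<theta>) * (x i - z i) + \<theta> * (y i - w i))"
      by (simp add: fun_eq_iff algebra_simps)
    also have "f \<dots> \<le> (1 - \<theta>) * f (\<lambda>i. x i - z i) + \<theta> * f (\<lambda>i. y i - w i)"
      by (rule convex_funD[OF cv t])
    also have "(\<Sum>i\<in>I. (?v i)\<^sup>2) \<le> (\<Sum>i\<in>I. (1 - \<theta>) * (z i)\<^sup>2 + \<theta> * (w i)\<^sup>2)"
      by (intro sum_mono square_convex_comb t)
    also have "\<dots> = (1 - \<theta>) * (\<Sum>i\<in>I. (z i)\<^sup>2) + \<theta> * (\<Sum>i\<in>I. (w i)\<^sup>2)"
      by (simp add: sum.distrib sum_distrib_left)
    finally have "?Q (\<lambda>i. (1 - \<theta>) * x i + \<theta> * y i)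
       \<le> (1 - \<theta>) * (f (\<lambda>i. x i - z i) + k * (\<Sum>i\<in>I. (z i)\<^sup>2))
         + \<theta> * (f (\<lambda>i. y i - w i) + k * (\<Sum>i\<in>I. (w i)\<^sup>2))"
      using f(4) by (simp add: algebra_simps)
    also have "\<dots> \<le> (1 - \<theta>) * (?Q x + e) + \<theta> * (?Q y + e)"
      by (intro add_mono[OF mult_left_mono mult_left_mono]) (use t z(2) w(2) in auto)
    finally show "?Q (\<lambda>i. (1 - \<theta>) * x i + \<theta> * y i) \<le> (1 - \<theta>) * ?Q x + \<theta> * ?Q y + e"
      by (simp add: algebra_simps)
  qed
qed

text \<open>Shifts on disjoint \<open>I\<close> and \<open>K\<close> add up to a shift on the union,
  and so do their quadratic costs. Thus the shift on \<open>I\<close> may be fixed while the one on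
  \<open>K\<close> is optimised, which is what tensorisation needs.\<close>

lemma infconv_union_le:
  assumes f: "lip_on J L f" "finite J" "I \<subseteq> J" "K \<subseteq> J" "I \<inter> K = {}" "k > 0"
    and z: "\<And>i. i \<notin> I \<Longrightarrow> z i = 0"
  shows "infconv k (K \<union> I) f x \<le> infconv k K f (\<lambda>i. x i - z i) + k * (\<Sum>i\<in>I. (z i)\<^sup>2)"
proof -
  have "infconv k (K \<union> I) f x - k * (\<Sum>i\<in>I. (z i)\<^sup>2) \<le> infconv k K f (\<lambda>i. x i - z i)"
  proof (rule le_infconv)
    fix w assume w: "\<And>i. i \<notin> K \<Longrightarrow> w i = (0::real)"
    have fin: "finite K" "finite I" using f finite_subset[of _ J] by blast+
    have "infconv k (K \<union> I) f x
        \<le> f (\<lambda>i. x i - (z i + w i)) + k * (\<Sum>i\<in>K \<union> I. (z i + w i)\<^sup>2)"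
      by (rule infconv_le[OF f(1,2)]) (use f z w in auto)
    also have "(\<Sum>i\<in>K \<union> I. (z i + w i)\<^sup>2) = (\<Sum>i\<in>K. (z i + w i)\<^sup>2) + (\<Sum>i\<in>I. (z i + w i)\<^sup>2)"
      using fin f by (intro sum.union_disjoint) auto
    also have "(\<Sum>i\<in>K. (z i + w i)\<^sup>2) = (\<Sum>i\<in>K. (w i)\<^sup>2)"
      using f(5) z by (intro sum.cong refl) (metis IntI add_0 empty_iff)
    also have "(\<Sum>i\<in>I. (z i + w i)\<^sup>2) = (\<Sum>i\<in>I. (z i)\<^sup>2)"
      using f(5) w by (intro sum.cong refl) (metis IntI add.right_neutral empty_iff)
    finally show "infconv k (K \<union> I) f x - k * (\<Sum>i\<in>I. (z i)\<^sup>2)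
       \<le> f (\<lambda>i. x i - z i - w i) + k * (\<Sum>i\<in>K. (w i)\<^sup>2)"
      by (simp add: algebra_simps)
  qed
  then show ?thesis by simp
qed

section \<open>Continuity, measurability and integrability of Lipschitz functions\<close>

lemma lip_on_continuous:
  fixes f :: "('i \<Rightarrow> real) \<Rightarrow> real"
  assumes "lip_on J L f"
  shows "continuous_on UNIV f"
  unfolding continuous_on_def
proof
  fix x :: "'i \<Rightarrow> real"
  have coord: "((\<lambda>y. y i) \<longlongrightarrow> x i) (at x)" for i
  proof -
    have "continuous_on UNIV (\<lambda>y :: 'i \<Rightarrow> real. y i)" by simp
    then show ?thesis by (simp add: continuous_on_def)
  qed
  have "((\<lambda>y. L * (\<Sum>i\<in>J. \<bar>y i - x i\<bar>)) \<longlongrightarrow> L * (\<Sum>i\<in>J. \<bar>x i - x i\<bar>)) (at x)"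
    by (intro tendsto_intros coord)
  then have "((\<lambda>y. L * (\<Sum>i\<in>J. \<bar>y i - x i\<bar>)) \<longlongrightarrow> 0) (at x)" by simp
  then have "((\<lambda>y. f y - f x) \<longlongrightarrow> 0) (at x)"
    by (rule Lim_null_comparison[rotated])
      (use lip_onD[OF assms] in \<open>auto intro!: always_eventually\<close>)
  then show "(f \<longlongrightarrow> f x) (at x within UNIV)" by (simp add: LIM_zero_iff)
qed

text \<open>Continuity in the product topology gives Borel measurability, and over a countable index
  type a coordinatewise measurable map is Borel. Coordinates outside \<open>J\<close> are set to 0,
  which does not change the value of \<open>f\<close>.\<close>

lemma lip_on_measurable:
  fixes f :: "('i::countable \<Rightarrow> real) \<Rightarrow> real"
  assumes f: "lip_on J L f" and g: "\<And>i. i \<in> J \<Longrightarrow> (\<lambda>\<omega>. g \<omega> i) \<in> borel_measurable N"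
  shows "(\<lambda>\<omega>. f (g \<omega>)) \<in> borel_measurable N"
proof -
  let ?h = "\<lambda>\<omega> i. if i \<in> J then g \<omega> i else 0"
  have "?h \<in> borel_measurable N"
  proof (rule measurable_coordinatewise_then_product)
    show "(\<lambda>\<omega>. ?h \<omega> i) \<in> borel_measurable N" for i
      using g by (cases "i \<in> J") auto
  qed
  then have "(\<lambda>\<omega>. f (?h \<omega>)) \<in> borel_measurable N"
    using borel_measurable_continuous_onI[OF lip_on_continuous[OF f]] by (rule measurable_compose)
  also have "(\<lambda>\<omega>. f (?h \<omega>)) = (\<lambda>\<omega>. f (g \<omega>))"
    by (rule ext, rule lip_on_cong[OF f]) simp
  finally show ?thesis .
qed

lemma lip_on_bounded:
  fixes f :: "('i::countable \<Rightarrow> real) \<Rightarrow> real"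
  assumes f: "lip_on J L f" "finite J" and "0 \<le> L"
    and bd: "\<And>i. i \<in> J \<Longrightarrow> AE \<omega> in N. \<bar>g \<omega> i\<bar> \<le> c i"
  shows "AE \<omega> in N. \<bar>f (g \<omega>)\<bar> \<le> \<bar>f (\<lambda>_. 0)\<bar> + L * (\<Sum>i\<in>J. c i)"
proof -
  have "AE \<omega> in N. \<forall>i\<in>J. \<bar>g \<omega> i\<bar> \<le> c i"
    using bd by (intro AE_finite_allI f) auto
  then show ?thesis
  proof eventually_elim
    case (elim \<omega>)
    have "\<bar>f (g \<omega>) - f (\<lambda>_. 0)\<bar> \<le> L * (\<Sum>i\<in>J. \<bar>g \<omega> i\<bar>)"
      using lip_onD[OF f(1), of "g \<omega>" "\<lambda>_. 0"] by simp
    also have "\<dots> \<le> L * (\<Sum>i\<in>J. c i)"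
      using elim \<open>0 \<le> L\<close> by (intro mult_left_mono sum_mono) auto
    finally show ?case by linarith
  qed
qed

text \<open>Bounded coordinates keep \<open>f\<close> within a fixed distance of its value at the
  origin, so both functions are bounded almost everywhere on a finite measure.\<close>

lemma (in finite_measure) lip_on_integrable:
  fixes f :: "('i::countable \<Rightarrow> real) \<Rightarrow> real"
  assumes f: "lip_on J L f" "finite J" and "0 \<le> L"
    and g: "\<And>i. i \<in> J \<Longrightarrow> (\<lambda>\<omega>. g \<omega> i) \<in> borel_measurable M"
    and bd: "\<And>i. i \<in> J \<Longrightarrow> AE \<omega> in M. \<bar>g \<omega> i\<bar> \<le> c i"
  shows lip_on_integrable_exp: "integrable M (\<lambda>\<omega>. exp (f (g \<omega>)))"
    and lip_on_integrable_self: "integrable M (\<lambda>\<omega>. f (g \<omega>))"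
proof -
  have meas [measurable]: "(\<lambda>\<omega>. f (g \<omega>)) \<in> borel_measurable M"
    by (rule lip_on_measurable[OF f(1) g])
  have bound: "AE \<omega> in M. \<bar>f (g \<omega>)\<bar> \<le> \<bar>f (\<lambda>_. 0)\<bar> + L * (\<Sum>i\<in>J. c i)"
    by (rule lip_on_bounded[OF f \<open>0 \<le> L\<close> bd])
  show "integrable M (\<lambda>\<omega>. f (g \<omega>))"
    by (rule integrable_const_bound) (use bound in auto)
  show "integrable M (\<lambda>\<omega>. exp (f (g \<omega>)))"
  proof (rule integrable_const_bound)
    show "AE \<omega> in M. norm (exp (f (g \<omega>))) \<le> exp (\<bar>f (\<lambda>_. 0)\<bar> + L * (\<Sum>i\<in>J. c i))"
      using bound by eventually_elim auto
  qed simp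
qed

section \<open>Maurey's property for product measures\<close>

text \<open>Here \<open>h\<close> is the excess of a convex function over its minimum and
  \<open>\<theta>\<close> the fraction of the way moved towards the minimiser, at cost at most
  \<open>\<theta>\<^sup>2 / 4\<close>. The choice \<open>2 * h\<close> minimises the exponent, and
  the cap 1 keeps \<open>\<theta>\<close> a convex weight. For \<open>h \<le> 1/2\<close> the
  exponent is \<open>h - h\<^sup>2\<close> and a derivative settles the claim; beyond that it is the
  constant 1/4.\<close>

lemma exp_scalar_bound:
  fixes h :: real
  assumes "0 \<le> h"
  defines "\<theta> \<equiv> min 1 (2 * h)"
  shows "exp ((1 - \<theta>) * h + \<theta>\<^sup>2 / 4) \<le> 2 - exp (- h)"
proof (cases "h \<le> 1/2")
  case True
  let ?F = "\<lambda>h::real. exp (h - h\<^sup>2) + exp (- h)"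
  have "?F h \<le> ?F 0"
  proof (rule DERIV_nonpos_imp_nonincreasing[OF assms(1)])
    fix x :: real assume x: "0 \<le> x" "x \<le> h"
    \<comment> \<open>After factoring out \<open>exp (- x)\<close>, the derivative is nonpositive
      because \<open>1 - 2 * x \<le> exp (- 2 * x)\<close>.\<close>
    have "(1 - 2 * x) * exp (2 * x - x\<^sup>2) \<le> exp (- 2 * x) * exp (2 * x - x\<^sup>2)"
      using exp_ge_add_one_self[of "- 2 * x"] by (intro mult_right_mono) auto
    also have "\<dots> \<le> 1" by (simp flip: exp_add)
    finally have "(1 - 2 * x) * exp (2 * x - x\<^sup>2) * exp (- x) \<le> 1 * exp (- x)"
      by (intro mult_right_mono) auto
    then have "(1 - 2 * x) * exp (x - x\<^sup>2) - exp (- x) \<le> 0"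
      by (simp add: mult.assoc flip: exp_add)
    moreover have "(?F has_real_derivative (1 - 2 * x) * exp (x - x\<^sup>2) - exp (- x)) (at x)"
      by (auto intro!: derivative_eq_intros simp: algebra_simps)
    ultimately show "\<exists>y. (?F has_real_derivative y) (at x) \<and> y \<le> 0" by blast
  qed
  moreover have "(1 - \<theta>) * h + \<theta>\<^sup>2 / 4 = h - h\<^sup>2"
    using True by (simp add: \<theta>_def power2_eq_square algebra_simps)
  ultimately show ?thesis by simp
next
  case False
  \<comment> \<open>The two numerical bounds 21/16 and 2/3 add up to 95/48, just below 2.\<close>
  have "exp (1/4 :: real) \<le> 1 + 1/4 + (1/4)\<^sup>2"
    by (rule exp_bound) auto
  moreover have "exp (- (1/2) :: real) \<le> 2/3"
  proof -
    have "3/2 \<le> exp (1/2 :: real)" using exp_ge_add_one_self[of "1/2"] by simp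
    then show ?thesis by (simp add: exp_minus field_simps)
  qed
  moreover have "exp (- h) \<le> exp (- (1/2))" using False by simp
  ultimately have "exp (1/4 :: real) \<le> 2 - exp (- h)" unfolding power2_eq_square by linarith
  then show ?thesis using False by (simp add: \<theta>_def)
qed

text \<open>All coordinates but \<open>i\<close> are frozen at \<open>x\<close>. Comparing with the
  minimum over the interval, attained at \<open>y0\<close>, gives a pointwise bound of the form
  \<open>2 - exp (- h)\<close>; integrating it turns the product of the two integrals into something
  at most \<open>(2 - r) * r\<close>.\<close>

lemma tau_property_interval:
  fixes f :: "('i::countable \<Rightarrow> real) \<Rightarrow> real" and \<mu> :: "real measure"
  assumes "prob_space \<mu>" and sets [measurable_cong]: "sets \<mu> = sets borel"
    and supp: "AE y in \<mu>. \<bar>y\<bar> \<le> D / 2" and "D > 0"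
    and f: "lip_on J L f" "finite J" "i \<in> J" "0 \<le> L" and cv: "convex_fun f"
  shows "(\<integral>y. exp (infconv (1 / (4 * D\<^sup>2)) {i} f (x(i := y))) \<partial>\<mu>) *
         (\<integral>y. exp (- f (x(i := y))) \<partial>\<mu>) \<le> 1"
proof -
  interpret prob_space \<mu> by fact
  define k where "k = 1 / (4 * D\<^sup>2)"
  have k: "k > 0" using \<open>D > 0\<close> by (simp add: k_def)
  let ?Q = "\<lambda>y. infconv k {i} f (x(i := y))" and ?g = "\<lambda>y. f (x(i := y))"
  have meas: "(\<lambda>y. (x(i := y)) j) \<in> borel_measurable \<mu>" for j
    by (cases "j = i") auto
  have bd: "AE y in \<mu>. \<bar>(x(i := y)) j\<bar> \<le> (if j = i then D / 2 else \<bar>x j\<bar>)" for j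
    using supp by (cases "j = i") auto
  have lipQ: "lip_on J L (infconv k {i} f)"
    by (rule lip_on_infconv) (use f k in auto)
  have intQ: "integrable \<mu> (\<lambda>y. exp (?Q y))"
    by (rule lip_on_integrable_exp[OF lipQ f(2,4) meas bd])
  have intg: "integrable \<mu> (\<lambda>y. exp (- ?g y))"
    by (rule lip_on_integrable_exp[OF lip_on_uminus[OF f(1)] f(2,4) meas bd])
  have "continuous_on {- D / 2..D / 2} ?g"
  proof (rule continuous_on_compose2[OF lip_on_continuous[OF f(1)]])
    show "continuous_on {- D / 2..D / 2} (\<lambda>y. x(i := y))"
    proof (rule continuous_on_coordinatewise_then_product)
      show "continuous_on {- D / 2..D / 2} (\<lambda>y. (x(i := y)) j)" for j
        by (cases "j = i") (auto intro: continuous_intros)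
    qed
  qed simp
  then obtain y0 where y0: "y0 \<in> {- D / 2..D / 2}" "\<And>y. y \<in> {- D / 2..D / 2} \<Longrightarrow> ?g y0 \<le> ?g y"
    using continuous_attains_inf[of "{- D / 2..D / 2}" ?g] \<open>D > 0\<close> by auto
  have pointwise: "exp (?Q y - ?g y0) \<le> 2 - exp (- (?g y - ?g y0))" if y: "\<bar>y\<bar> \<le> D / 2" for y
  proof -
    define h where "h = ?g y - ?g y0"
    have h: "h \<ge> 0" unfolding h_def using y0(2)[of y] y unfolding atLeastAtMost_iff abs_le_iff by linarith
    define \<theta> where "\<theta> = min 1 (2 * h)"
    have \<theta>: "0 \<le> \<theta>" "\<theta> \<le> 1" using h by (auto simp: \<theta>_def)
    \<comment> \<open>The shift moves \<open>y\<close> the fraction \<open>\<theta>\<close> of the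
      way to \<open>y0\<close>. Convexity controls \<open>f\<close> there, and the cost is at most
      \<open>\<theta>\<^sup>2 / 4\<close> because both points lie in an interval of length
      \<open>D\<close>.\<close>
    let ?z = "\<lambda>j. if j = i then \<theta> * (y - y0) else 0"
    have "?Q y \<le> f (\<lambda>j. (x(i := y)) j - ?z j) + k * (\<Sum>j\<in>{i}. (?z j)\<^sup>2)"
      by (rule infconv_le[OF f(1,2)]) (use f k in auto)
    also have "(\<lambda>j. (x(i := y)) j - ?z j) = (\<lambda>j. (1 - \<theta>) * (x(i := y)) j + \<theta> * (x(i := y0)) j)"
      by (simp add: fun_eq_iff algebra_simps)
    also have "f \<dots> \<le> (1 - \<theta>) * ?g y + \<theta> * ?g y0"
      by (rule convex_funD[OF cv \<theta>])
    also have "k * (\<Sum>j\<in>{i}. (?z j)\<^sup>2) \<le> \<theta>\<^sup>2 / 4"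
    proof -
      have "\<bar>y - y0\<bar> \<le> D" using y y0(1) by auto
      then have "(y - y0)\<^sup>2 \<le> D\<^sup>2" using \<open>D > 0\<close> by (simp add: abs_le_square_iff[symmetric])
      then have "\<theta>\<^sup>2 * (y - y0)\<^sup>2 \<le> \<theta>\<^sup>2 * D\<^sup>2" by (intro mult_left_mono) auto
      then show ?thesis using \<open>D > 0\<close> by (simp add: k_def power_mult_distrib divide_le_eq mult_ac)
    qed
    finally have "?Q y - ?g y0 \<le> (1 - \<theta>) * h + \<theta>\<^sup>2 / 4"
      by (simp add: h_def algebra_simps del: fun_upd_apply)
    then have "exp (?Q y - ?g y0) \<le> exp ((1 - \<theta>) * h + \<theta>\<^sup>2 / 4)" by simp
    also have "\<dots> \<le> 2 - exp (- h)"
      unfolding \<theta>_def by (rule exp_scalar_bound[OF h])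
    finally show ?thesis by (simp add: h_def)
  qed
  define a where "a = (\<integral>y. exp (?Q y) \<partial>\<mu>)"
  define b where "b = (\<integral>y. exp (- ?g y) \<partial>\<mu>)"
  have "(\<integral>y. exp (?Q y) * exp (- ?g y0) \<partial>\<mu>) \<le> (\<integral>y. 2 - exp (- ?g y) * exp (?g y0) \<partial>\<mu>)"
  proof (rule integral_mono_AE)
    show "AE y in \<mu>. exp (?Q y) * exp (- ?g y0) \<le> 2 - exp (- ?g y) * exp (?g y0)"
      using supp
    proof eventually_elim
      case (elim y)
      from pointwise[OF this] show ?case by (simp flip: exp_add)
    qed
  qed (use intQ intg in auto)
  then have 1: "a * exp (- ?g y0) \<le> 2 - b * exp (?g y0)"
    using intQ intg by (simp add: a_def b_def prob_space)
  have b: "b \<ge> 0" unfolding b_def by (intro Bochner_Integration.integral_nonneg) auto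
  \<comment> \<open>Normalising by the minimum value: \<open>r\<close> is the integral of
    \<open>exp (- h)\<close>, where \<open>h\<close> is the excess of \<open>f\<close> over that
    value, so the inequality labelled 1 bounds the other normalised integral by
    \<open>2 - r\<close>.\<close>
  define r where "r = b * exp (?g y0)"
  have "a * b = (a * exp (- ?g y0)) * r"
    by (simp add: r_def exp_minus field_simps)
  also have "\<dots> \<le> (2 - r) * r"
    using 1 b by (intro mult_right_mono) (auto simp: r_def)
  also have "\<dots> \<le> 1"
    using zero_le_power2[of "r - 1"] by (simp add: power2_eq_square algebra_simps)
  finally show ?thesis by (simp add: a_def b_def k_def)
qed

section \<open>Log-integrals of exponentials and tensorisation\<close>

lemma (in prob_space) integral_exp_pos:
  fixes g :: "'a \<Rightarrow> real"
  assumes "integrable M (\<lambda>y. exp (g y))"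
  shows "0 < (\<integral>y. exp (g y) \<partial>M)"
proof -
  have "(\<integral>y. exp (g y) \<partial>M) \<noteq> 0"
    using integral_nonneg_eq_0_iff_AE[OF assms] by simp
  moreover have "0 \<le> (\<integral>y. exp (g y) \<partial>M)"
    by (intro Bochner_Integration.integral_nonneg) simp
  ultimately show ?thesis by linarith
qed

text \<open>This is Hoelder's inequality in logarithmic form. Subtracting the logarithms of the
  integrals normalises both exponentials to integral 1, after which pointwise convexity of
  \<open>exp\<close> suffices.\<close>

lemma (in prob_space) convex_fun_ln_integral_exp:
  assumes H: "\<And>y. convex_fun (\<lambda>x. H x y)" and int: "\<And>x. integrable M (\<lambda>y. exp (H x y))"
  shows "convex_fun (\<lambda>x :: 'i \<Rightarrow> real. ln (\<integral>y. exp (H x y) \<partial>M))"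
  unfolding convex_fun_def
proof (intro allI impI)
  fix x x' :: "'i \<Rightarrow> real" and \<theta> :: real assume t: "0 \<le> \<theta>" "\<theta> \<le> 1"
  let ?I = "\<lambda>x :: 'i \<Rightarrow> real. \<integral>y. exp (H x y) \<partial>M"
  have pos: "?I x > 0" for x
    by (rule integral_exp_pos[OF int])
  let ?w = "\<lambda>i. (1 - \<theta>) * x i + \<theta> * x' i"
  let ?c = "(1 - \<theta>) * ln (?I x) + \<theta> * ln (?I x')"
  have "?I ?w * exp (- ?c) = (\<integral>y. exp (H ?w y - ?c) \<partial>M)"
    using integral_mult_left_zero[of M "\<lambda>y. exp (H ?w y)" "exp (- ?c)"]
    by (simp only: diff_conv_add_uminus exp_add)
  also have "\<dots> \<le> (\<integral>y. (1 - \<theta>) * (exp (H x y) / ?I x) + \<theta> * (exp (H x' y) / ?I x') \<partial>M)"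
  proof (rule integral_mono)
    fix y
    have "H ?w y - ?c \<le> (1 - \<theta>) * (H x y - ln (?I x)) + \<theta> * (H x' y - ln (?I x'))"
      using convex_funD[OF H t, of x x' y] by (simp add: algebra_simps)
    then have "exp (H ?w y - ?c) \<le> exp ((1 - \<theta>) * (H x y - ln (?I x)) + \<theta> * (H x' y - ln (?I x')))"
      by simp
    also have "\<dots> \<le> (1 - \<theta>) * exp (H x y - ln (?I x)) + \<theta> * exp (H x' y - ln (?I x'))"
      using convex_onD[OF exp_convex t] by simp
    finally show "exp (H ?w y - ?c) \<le> (1 - \<theta>) * (exp (H x y) / ?I x) + \<theta> * (exp (H x' y) / ?I x')"
      using pos by (simp add: exp_diff)
  qed (use int in \<open>auto simp: exp_diff\<close>)
  also have "\<dots> = 1"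
    using pos[of x] pos[of x'] int by simp
  finally have "?I ?w * exp (- ?c) * exp ?c \<le> 1 * exp ?c"
    by (intro mult_right_mono) auto
  then have "?I ?w \<le> exp ?c"
    by (simp only: mult.assoc flip: exp_add) simp
  then show "ln (?I ?w) \<le> ?c"
    using pos[of ?w] by (metis ln_exp ln_le_cancel_iff exp_gt_zero)
qed

text \<open>An additive bound on \<open>H\<close>, uniform in \<open>y\<close>, becomes a
  multiplicative bound on the integrals and an additive one again after taking
  \<open>ln\<close>.\<close>

lemma (in prob_space) lip_on_ln_integral_exp:
  assumes H: "\<And>x x' y. \<bar>H x y - H x' y\<bar> \<le> L * (\<Sum>i\<in>I. \<bar>x i - x' i\<bar>)"
    and int: "\<And>x. integrable M (\<lambda>y. exp (H x y))"
  shows "lip_on I L (\<lambda>x. ln (\<integral>y. exp (H x y) \<partial>M))"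
proof -
  let ?I = "\<lambda>x. \<integral>y. exp (H x y) \<partial>M"
  have pos: "?I x > 0" for x
    by (rule integral_exp_pos[OF int])
  have le: "ln (?I x) \<le> ln (?I x') + L * (\<Sum>i\<in>I. \<bar>x i - x' i\<bar>)" for x x'
  proof -
    let ?d = "L * (\<Sum>i\<in>I. \<bar>x i - x' i\<bar>)"
    have "?I x \<le> (\<integral>y. exp ?d * exp (H x' y) \<partial>M)"
    proof (rule integral_mono)
      show "exp (H x y) \<le> exp ?d * exp (H x' y)" for y
        using H[of x y x'] by (simp flip: exp_add)
    qed (use int in auto)
    also have "\<dots> = exp ?d * ?I x'" by simp
    finally have "ln (?I x) \<le> ln (exp ?d * ?I x')"
      using pos[of x] pos[of x'] by simp
    then show ?thesis using pos[of x'] by (simp add: ln_mult)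
  qed
  show ?thesis
    unfolding lip_on_def
  proof (intro allI)
    fix x x'
    show "\<bar>ln (?I x) - ln (?I x')\<bar> \<le> L * (\<Sum>i\<in>I. \<bar>x i - x' i\<bar>)"
      using le[of x x'] le[of x' x] by (simp add: abs_minus_commute abs_le_iff)
  qed
qed

text \<open>Induction on the index set. The new coordinate is integrated out into
  \<open>\<phi>\<close>; step \<open>A\<close> compares the convolutions of \<open>f\<close> and
  \<open>\<phi>\<close>, step \<open>B\<close> compares \<open>exp (- f)\<close> with
  \<open>exp (- \<phi>)\<close>, and the induction hypothesis for \<open>\<phi>\<close> bounds the
  product.\<close>

lemma tau_property_PiM:
  fixes f :: "('i::countable \<Rightarrow> real) \<Rightarrow> real" and \<mu> :: "'i \<Rightarrow> real measure"
  assumes \<mu>: "\<And>i. prob_space (\<mu> i)" and sets: "\<And>i. sets (\<mu> i) = sets borel"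
    and supp: "\<And>i. AE y in \<mu> i. \<bar>y\<bar> \<le> D / 2" and D: "D > 0"
    and I: "finite I" and f: "lip_on I L f" "0 \<le> L" and cv: "convex_fun f"
  shows "(\<integral>x. exp (infconv (1 / (4 * D\<^sup>2)) I f x) \<partial>PiM I \<mu>) * (\<integral>x. exp (- f x) \<partial>PiM I \<mu>) \<le> 1"
  using I f cv
proof (induction I arbitrary: f rule: finite_induct)
  case (empty f)
  \<comment> \<open>The zero shift is admissible, and the empty product is a point mass, so the two
    integrals are just point values.\<close>
  have "infconv (1 / (4 * D\<^sup>2)) {} f x \<le> f x" for x
    using infconv_le[OF empty(1), of "{}" "1 / (4 * D\<^sup>2)" "\<lambda>_. 0" x] D by simp
  then show ?case by (simp add: PiM_empty lebesgue_integral_count_space_finite flip: exp_add)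
next
  case (insert i I f)
  define k where "k = 1 / (4 * D\<^sup>2)"
  have k: "k > 0" using D by (simp add: k_def)
  interpret product_sigma_finite \<mu>
    by (intro product_sigma_finite.intro prob_space_imp_sigma_finite \<mu>)
  interpret \<mu>i: prob_space "\<mu> i" by (rule \<mu>)
  let ?J = "insert i I"
  note fJ = insert.prems(1)
  have finJ: "finite ?J" using insert by simp
  have comp: "(\<lambda>x. x j) \<in> borel_measurable (PiM K \<mu>)" if "j \<in> K" for j K
    using measurable_component_singleton[OF that, of \<mu>] measurable_cong_sets[OF refl sets[of j]]
    by blast
  have supp': "AE x in PiM K \<mu>. \<bar>x j\<bar> \<le> D / 2" if "j \<in> K" for j K
    by (rule AE_PiM_component[OF \<mu> that supp])
  have int_PiM: "integrable (PiM K \<mu>) (\<lambda>x. exp (g x))" if "lip_on K L g" "finite K" for g K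
  proof -
    interpret P: prob_space "PiM K \<mu>" by (rule prob_space_PiM) (rule \<mu>)
    show ?thesis
      by (rule P.lip_on_integrable_exp[OF that insert.prems(2) comp supp'])
  qed
  have int_coord: "integrable (\<mu> i) (\<lambda>y. exp (g (x(i := y))))" if "lip_on ?J L g" for g x
  proof (rule \<mu>i.lip_on_integrable_exp[OF that finJ insert.prems(2)])
    show "(\<lambda>y. (x(i := y)) j) \<in> borel_measurable (\<mu> i)" for j
      using sets by (cases "j = i") (auto simp: measurable_cong_sets[OF sets refl])
    show "AE y in \<mu> i. \<bar>(x(i := y)) j\<bar> \<le> (if j = i then D / 2 else \<bar>x j\<bar>)" for j
      using supp[of i] by (cases "j = i") auto
  qed
  have lip_slice: "\<bar>g (x(i := y)) - g (x'(i := y))\<bar> \<le> L * (\<Sum>j\<in>I. \<bar>x j - x' j\<bar>)"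
    if "lip_on ?J L g" for g x x' y
  proof -
    have "(\<Sum>j\<in>?J. \<bar>(x(i := y)) j - (x'(i := y)) j\<bar>) = (\<Sum>j\<in>I. \<bar>x j - x' j\<bar>)"
      using insert.hyps by (simp, intro sum.cong) auto
    then show ?thesis using lip_onD[OF that, of "x(i := y)" "x'(i := y)"] by simp
  qed
  let ?H = "\<lambda>x y. infconv k {i} f (x(i := y))"
  \<comment> \<open>Integrating out the new coordinate with its own infimal convolution keeps the function convex
    and Lipschitz, so the induction hypothesis applies to \<open>\<phi>\<close>.\<close>
  define \<phi> where "\<phi> = (\<lambda>x. ln (\<integral>y. exp (?H x y) \<partial>\<mu> i))"
  have lipH: "lip_on ?J L (infconv k {i} f)"
    by (rule lip_on_infconv[OF fJ finJ _ k]) simp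
  have cvH: "convex_fun (infconv k {i} f)"
    by (rule convex_fun_infconv[OF fJ finJ _ k insert.prems(3)]) simp
  have intH: "integrable (\<mu> i) (\<lambda>y. exp (?H x y))" for x
    by (rule int_coord[OF lipH])
  have exp_\<phi>: "exp (\<phi> x) = (\<integral>y. exp (?H x y) \<partial>\<mu> i)" for x
    unfolding \<phi>_def using \<mu>i.integral_exp_pos[OF intH] by simp
  have lip\<phi>: "lip_on I L \<phi>"
    unfolding \<phi>_def by (rule \<mu>i.lip_on_ln_integral_exp[OF lip_slice[OF lipH] intH])
  have cv\<phi>: "convex_fun \<phi>"
    unfolding \<phi>_def
  proof (rule \<mu>i.convex_fun_ln_integral_exp[OF _ intH])
    fix y
    show "convex_fun (\<lambda>x. ?H x y)"
      unfolding convex_fun_def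
    proof (intro allI impI)
      fix x x' and \<theta> :: real assume t: "0 \<le> \<theta>" "\<theta> \<le> 1"
      have "(\<lambda>j. (1 - \<theta>) * x j + \<theta> * x' j)(i := y)
          = (\<lambda>j. (1 - \<theta>) * (x(i := y)) j + \<theta> * (x'(i := y)) j)"
        by (simp add: fun_eq_iff algebra_simps)
      then show "?H (\<lambda>j. (1 - \<theta>) * x j + \<theta> * x' j) y \<le> (1 - \<theta>) * ?H x y + \<theta> * ?H x' y"
        using convex_funD[OF cvH t, of "x(i := y)" "x'(i := y)"] by (simp only:)
    qed
  qed
  have IH: "(\<integral>x. exp (infconv k I \<phi> x) \<partial>PiM I \<mu>) * (\<integral>x. exp (- \<phi> x) \<partial>PiM I \<mu>) \<le> 1"
    unfolding k_def by (rule insert.IH[OF lip\<phi> insert.prems(2) cv\<phi>])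
  have lipQ: "lip_on ?J L (infconv k ?J f)"
    by (rule lip_on_infconv[OF fJ finJ subset_refl k])
  have lipN: "lip_on ?J L (\<lambda>x. - f x)"
    by (rule lip_on_uminus[OF fJ])
  \<comment> \<open>For a fixed shift \<open>z\<close> on \<open>I\<close>, the full convolution is
    at most the convolution in coordinate \<open>i\<close> at the shifted point plus the cost of
    \<open>z\<close>. Integrating over coordinate \<open>i\<close> and then taking the infimum over
    \<open>z\<close> yields the convolution of \<open>\<phi>\<close>.\<close>
  have A: "(\<integral>x. exp (infconv k ?J f x) \<partial>PiM ?J \<mu>) \<le> (\<integral>x. exp (infconv k I \<phi> x) \<partial>PiM I \<mu>)"
  proof -
    \<comment> \<open>Writing the inner integral as the exponential of a Lipschitz function makes
      \<open>int_PiM\<close> applicable to it.\<close>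
    have lip\<psi>: "lip_on I L (\<lambda>x. ln (\<integral>y. exp (infconv k ?J f (x(i := y))) \<partial>\<mu> i))"
      by (rule \<mu>i.lip_on_ln_integral_exp[OF lip_slice[OF lipQ] int_coord[OF lipQ]])
    have \<psi>: "exp (ln (\<integral>y. exp (infconv k ?J f (x(i := y))) \<partial>\<mu> i))
        = (\<integral>y. exp (infconv k ?J f (x(i := y))) \<partial>\<mu> i)" for x
      using \<mu>i.integral_exp_pos[OF int_coord[OF lipQ]] by simp
    have "(\<integral>x. exp (infconv k ?J f x) \<partial>PiM ?J \<mu>)
        = (\<integral>x. (\<integral>y. exp (infconv k ?J f (x(i := y))) \<partial>\<mu> i) \<partial>PiM I \<mu>)"
      by (rule product_integral_insert[OF insert.hyps int_PiM[OF lipQ finJ]])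
    also have "\<dots> \<le> (\<integral>x. exp (infconv k I \<phi> x) \<partial>PiM I \<mu>)"
    proof (rule integral_mono)
      show "integrable (PiM I \<mu>) (\<lambda>x. \<integral>y. exp (infconv k ?J f (x(i := y))) \<partial>\<mu> i)"
        using int_PiM[OF lip\<psi> insert.hyps(1)] by (simp only: \<psi>)
      show "integrable (PiM I \<mu>) (\<lambda>x. exp (infconv k I \<phi> x))"
        by (rule int_PiM[OF lip_on_infconv[OF lip\<phi> insert.hyps(1) subset_refl k] insert.hyps(1)])
      fix x
      have "ln (\<integral>y. exp (infconv k ?J f (x(i := y))) \<partial>\<mu> i) \<le> infconv k I \<phi> x"
      proof (rule le_infconv)
        fix z assume z: "\<And>j. j \<notin> I \<Longrightarrow> z j = (0::real)"
        let ?x' = "\<lambda>j. x j - z j" and ?c = "k * (\<Sum>j\<in>I. (z j)\<^sup>2)"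
        have "(\<integral>y. exp (infconv k ?J f (x(i := y))) \<partial>\<mu> i) \<le> (\<integral>y. exp ?c * exp (?H ?x' y) \<partial>\<mu> i)"
        proof (rule integral_mono[OF int_coord[OF lipQ]])
          show "integrable (\<mu> i) (\<lambda>y. exp ?c * exp (?H ?x' y))" using intH by simp
          fix y
          have "infconv k ({i} \<union> I) f (x(i := y)) \<le> infconv k {i} f (\<lambda>j. (x(i := y)) j - z j) + ?c"
            by (rule infconv_union_le[OF fJ finJ]) (use insert.hyps k z in auto)
          also have "(\<lambda>j. (x(i := y)) j - z j) = ?x'(i := y)"
            using z[of i] insert.hyps by (simp add: fun_eq_iff)
          finally show "exp (infconv k ?J f (x(i := y))) \<le> exp ?c * exp (?H ?x' y)"
            by (simp add: add.commute del: fun_upd_apply flip: exp_add)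
        qed
        also have "\<dots> = exp (\<phi> ?x' + ?c)"
          by (simp add: exp_\<phi> exp_add)
        finally show "ln (\<integral>y. exp (infconv k ?J f (x(i := y))) \<partial>\<mu> i) \<le> \<phi> ?x' + ?c"
          by (subst exp_le_cancel_iff[symmetric]) (simp only: \<psi>)
      qed
      then have "exp (ln (\<integral>y. exp (infconv k ?J f (x(i := y))) \<partial>\<mu> i)) \<le> exp (infconv k I \<phi> x)"
        by (rule iffD2[OF exp_le_cancel_iff])
      then show "(\<integral>y. exp (infconv k ?J f (x(i := y))) \<partial>\<mu> i) \<le> exp (infconv k I \<phi> x)"
        by (simp only: \<psi>)
    qed
    finally show ?thesis .
  qed
  \<comment> \<open>For each fixed \<open>x\<close> the one-dimensional property in coordinate
    \<open>i\<close> bounds the inner integral by \<open>exp (- \<phi> x)\<close>.\<close>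
  have B: "(\<integral>x. exp (- f x) \<partial>PiM ?J \<mu>) \<le> (\<integral>x. exp (- \<phi> x) \<partial>PiM I \<mu>)"
  proof -
    have lip\<chi>: "lip_on I L (\<lambda>x. ln (\<integral>y. exp (- f (x(i := y))) \<partial>\<mu> i))"
      by (rule \<mu>i.lip_on_ln_integral_exp[OF lip_slice[OF lipN] int_coord[OF lipN]])
    have \<chi>: "exp (ln (\<integral>y. exp (- f (x(i := y))) \<partial>\<mu> i)) = (\<integral>y. exp (- f (x(i := y))) \<partial>\<mu> i)" for x
      using \<mu>i.integral_exp_pos[OF int_coord[OF lipN]] by simp
    have "(\<integral>x. exp (- f x) \<partial>PiM ?J \<mu>) = (\<integral>x. (\<integral>y. exp (- f (x(i := y))) \<partial>\<mu> i) \<partial>PiM I \<mu>)"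
      by (rule product_integral_insert[OF insert.hyps int_PiM[OF lipN finJ]])
    also have "\<dots> \<le> (\<integral>x. exp (- \<phi> x) \<partial>PiM I \<mu>)"
    proof (rule integral_mono)
      show "integrable (PiM I \<mu>) (\<lambda>x. \<integral>y. exp (- f (x(i := y))) \<partial>\<mu> i)"
        using int_PiM[OF lip\<chi> insert.hyps(1)] by (simp only: \<chi>)
      show "integrable (PiM I \<mu>) (\<lambda>x. exp (- \<phi> x))"
        by (rule int_PiM[OF lip_on_uminus[OF lip\<phi>] insert.hyps(1)])
      fix x
      have "exp (\<phi> x) * (\<integral>y. exp (- f (x(i := y))) \<partial>\<mu> i) \<le> 1"
        unfolding exp_\<phi> k_def
        by (rule tau_property_interval[OF \<mu> sets supp D fJ finJ _ insert.prems(2,3)]) simp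
      then show "(\<integral>y. exp (- f (x(i := y))) \<partial>\<mu> i) \<le> exp (- \<phi> x)"
        by (simp add: exp_minus field_simps)
    qed
    finally show ?thesis .
  qed
  have "(\<integral>x. exp (infconv k ?J f x) \<partial>PiM ?J \<mu>) * (\<integral>x. exp (- f x) \<partial>PiM ?J \<mu>)
      \<le> (\<integral>x. exp (infconv k I \<phi> x) \<partial>PiM I \<mu>) * (\<integral>x. exp (- \<phi> x) \<partial>PiM I \<mu>)"
    by (intro mult_mono A B Bochner_Integration.integral_nonneg) auto
  with IH show ?case by (simp add: k_def)
qed

section \<open>Concentration of convex Lipschitz functions\<close>

text \<open>Chernoff's method for \<open>g\<close>, the function \<open>f\<close> scaled by
  \<open>l\<close>: the product property and the lower bound \<open>Q_ge\<close> control the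
  exponential moment of \<open>g\<close>, once Jensen's inequality has replaced the mean of
  \<open>exp (- g)\<close> by \<open>exp\<close> of minus the mean of \<open>g\<close>.\<close>

lemma (in prob_space) convex_concentration:
  fixes X :: "'i::finite \<Rightarrow> 'a \<Rightarrow> real" and f :: "('i \<Rightarrow> real) \<Rightarrow> real"
  assumes indep: "indep_vars (\<lambda>_. borel) X UNIV"
    and bd: "\<And>i. AE \<omega> in M. \<bar>X i \<omega>\<bar> \<le> D / 2"
    and lip: "\<And>x y. \<bar>f x - f y\<bar> \<le> K * L2_set (\<lambda>i. x i - y i) UNIV"
    and cv: "convex_fun f" and D: "D > 0" and K: "K > 0" and t: "t > 0"
  shows "prob {\<omega> \<in> space M. f (\<lambda>i. X i \<omega>) > expectation (\<lambda>\<omega>. f (\<lambda>i. X i \<omega>)) + t}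
    \<le> exp (- (t\<^sup>2 / (4 * D\<^sup>2 * K\<^sup>2)))"
proof -
  have X [measurable]: "X i \<in> borel_measurable M" for i
    using indep by (auto simp: indep_vars_def)
  define \<mu> where "\<mu> = (\<lambda>i. distr M borel (X i))"
  \<comment> \<open>Independence says that the joint law is the product of the marginals, so
    integrals over the product measure become expectations.\<close>
  have PiM_eq: "PiM UNIV \<mu> = distr M (PiM UNIV (\<lambda>_. borel)) (\<lambda>\<omega> i. X i \<omega>)"
    using indep indep_vars_iff_distr_eq_PiM'[where I = UNIV and M' = "\<lambda>_. borel" and X = X]
    by (simp add: \<mu>_def restrict_def)
  have integral_PiM: "(\<integral>x. exp (h x) \<partial>PiM UNIV \<mu>) = expectation (\<lambda>\<omega>. exp (h (\<lambda>i. X i \<omega>)))"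
    if "lip_on UNIV L h" for h and L :: real
  proof -
    have "h \<in> borel_measurable (PiM UNIV (\<lambda>_. borel))"
      using that by (rule lip_on_measurable) (rule measurable_component_singleton)
    moreover have "(\<lambda>\<omega> i. X i \<omega>) \<in> measurable M (PiM UNIV (\<lambda>_. borel))"
      by (rule measurable_PiM_single') auto
    ultimately show ?thesis
      unfolding PiM_eq by (intro integral_distr) auto
  qed
  \<comment> \<open>The l2 norm is at most the l1 norm, so the Euclidean hypothesis also yields the
    form \<open>lip_on\<close> required for regularity.\<close>
  have lip1: "lip_on UNIV K f"
    unfolding lip_on_def
  proof (intro allI)
    fix x y :: "'i \<Rightarrow> real"
    have "K * L2_set (\<lambda>i. x i - y i) UNIV \<le> K * (\<Sum>i\<in>UNIV. \<bar>x i - y i\<bar>)"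
      using K by (intro mult_left_mono L2_set_le_sum_abs) auto
    then show "\<bar>f x - f y\<bar> \<le> K * (\<Sum>i\<in>UNIV. \<bar>x i - y i\<bar>)"
      using lip[of x y] by linarith
  qed
  \<comment> \<open>the minimiser of \<open>l\<^sup>2 * K\<^sup>2 * D\<^sup>2 - l * t\<close>\<close>
  define l where "l = t / (2 * D\<^sup>2 * K\<^sup>2)"
  have l: "l > 0" using t D K by (simp add: l_def)
  define g where "g = (\<lambda>x. l * f x)"
  define k where "k = 1 / (4 * D\<^sup>2)"
  have k: "k > 0" using D by (simp add: k_def)
  define c where "c = l\<^sup>2 * K\<^sup>2 * D\<^sup>2"
  have lipg: "lip_on UNIV (l * K) g"
    using lip_on_cmult[OF lip1, of l] l by (simp add: g_def)
  have cvg: "convex_fun g"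
    unfolding g_def by (rule convex_fun_cmult[OF cv]) (use l in simp)
  have lK: "l * K \<ge> 0" using l K by simp
  have lipQ: "lip_on UNIV (l * K) (infconv k UNIV g)"
    by (rule lip_on_infconv[OF lipg]) (use k in auto)
  have int: "integrable M (\<lambda>\<omega>. exp (h (\<lambda>i. X i \<omega>)))" if "lip_on UNIV (l * K) h" for h
    by (rule lip_on_integrable_exp[OF that finite lK X bd])
  \<comment> \<open>The Euclidean bound is used here on the whole shift at once, so the loss
    \<open>c\<close> is free of a dimension factor: it is the maximum over \<open>n\<close> of
    \<open>l * K * n - k * n\<^sup>2\<close>, obtained by completing the square.\<close>
  have Q_ge: "g x - c \<le> infconv k UNIV g x" for x
  proof (rule le_infconv)
    fix z :: "'i \<Rightarrow> real"
    let ?n = "L2_set z UNIV"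
    have "g x - g (\<lambda>i. x i - z i) \<le> l * (K * ?n)"
      unfolding g_def right_diff_distrib[symmetric]
      using lip[of x "\<lambda>i. x i - z i"] l by (intro mult_left_mono) auto
    also have "\<dots> \<le> k * ?n\<^sup>2 + c"
    proof -
      have "0 \<le> (?n / (2 * D) - l * K * D)\<^sup>2" by simp
      also have "\<dots> = k * ?n\<^sup>2 + c - l * (K * ?n)"
        using D by (simp add: k_def c_def power2_diff power_mult_distrib power_divide)
      finally show ?thesis by simp
    qed
    also have "?n\<^sup>2 = (\<Sum>i\<in>UNIV. (z i)\<^sup>2)"
      by (simp add: L2_set_def sum_nonneg)
    finally show "g x - c \<le> g (\<lambda>i. x i - z i) + k * (\<Sum>i\<in>UNIV. (z i)\<^sup>2)" by simp
  qed
  let ?g = "\<lambda>\<omega>. g (\<lambda>i. X i \<omega>)"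
  have "(\<integral>x. exp (infconv k UNIV g x) \<partial>PiM UNIV \<mu>) * (\<integral>x. exp (- g x) \<partial>PiM UNIV \<mu>) \<le> 1"
    unfolding k_def
  proof (rule tau_property_PiM[OF _ _ _ D finite lipg lK cvg])
    show "prob_space (\<mu> i)" for i by (simp add: \<mu>_def prob_space_distr)
    show "AE y in \<mu> i. \<bar>y\<bar> \<le> D / 2" for i
      unfolding \<mu>_def using bd[of i] by (subst AE_distr_iff) auto
  qed (simp add: \<mu>_def)
  then have tau: "expectation (\<lambda>\<omega>. exp (infconv k UNIV g (\<lambda>i. X i \<omega>))) * expectation (\<lambda>\<omega>. exp (- ?g \<omega>)) \<le> 1"
    by (simp only: integral_PiM[OF lipQ] integral_PiM[OF lip_on_uminus[OF lipg]])
  have intg: "integrable M ?g"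
    by (rule lip_on_integrable_self[OF lipg finite lK X bd])
  have intN: "integrable M (\<lambda>\<omega>. exp (- ?g \<omega>))"
    by (rule int[OF lip_on_uminus[OF lipg]])
  have jensen: "exp (- expectation ?g) \<le> expectation (\<lambda>\<omega>. exp (- ?g \<omega>))"
    using jensens_inequality[where X = "\<lambda>\<omega>. - ?g \<omega>" and I = UNIV and q = exp] intg intN exp_convex by simp
  have "expectation (\<lambda>\<omega>. exp (?g \<omega>)) * exp (- c) = expectation (\<lambda>\<omega>. exp (?g \<omega> - c))"
    by (simp add: exp_diff exp_minus divide_inverse)
  also have "\<dots> \<le> expectation (\<lambda>\<omega>. exp (infconv k UNIV g (\<lambda>i. X i \<omega>)))"
  proof (rule integral_mono)
    show "integrable M (\<lambda>\<omega>. exp (?g \<omega> - c))" using int[OF lipg] by (simp add: exp_diff)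
  qed (use int[OF lipQ] Q_ge in auto)
  finally have "expectation (\<lambda>\<omega>. exp (?g \<omega>)) * exp (- c) * exp (- expectation ?g)
     \<le> expectation (\<lambda>\<omega>. exp (infconv k UNIV g (\<lambda>i. X i \<omega>))) * expectation (\<lambda>\<omega>. exp (- ?g \<omega>))"
    by (intro mult_mono jensen Bochner_Integration.integral_nonneg) auto
  also note tau
  finally have mgf: "expectation (\<lambda>\<omega>. exp (?g \<omega>)) \<le> exp (c + expectation ?g)"
    by (simp add: exp_add exp_minus field_simps)
  let ?S = "{\<omega> \<in> space M. f (\<lambda>i. X i \<omega>) > expectation (\<lambda>\<omega>. f (\<lambda>i. X i \<omega>)) + t}"
  let ?a = "expectation ?g + l * t"
  have Eg: "expectation ?g = l * expectation (\<lambda>\<omega>. f (\<lambda>i. X i \<omega>))"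
    by (simp add: g_def)
  have meas [measurable]: "?g \<in> borel_measurable M" using intg by simp
  have "prob ?S \<le> prob {\<omega> \<in> space M. exp ?a \<le> exp (?g \<omega>)}"
  proof (rule finite_measure_mono)
    show "?S \<subseteq> {\<omega> \<in> space M. exp ?a \<le> exp (?g \<omega>)}"
      unfolding Eg using l by (auto simp: g_def simp flip: distrib_left)
  qed measurable
  also have "\<dots> \<le> expectation (\<lambda>\<omega>. exp (?g \<omega>)) / exp ?a"
    by (rule integral_Markov_inequality_measure[where A = "{}"]) (use int[OF lipg] in auto)
  also have "\<dots> \<le> exp (c + expectation ?g) / exp ?a"
    by (intro divide_right_mono mgf) simp
  also have "\<dots> = exp (c - l * t)"
    by (simp flip: exp_diff)
  also have "c - l * t = - (t\<^sup>2 / (4 * D\<^sup>2 * K\<^sup>2))"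
    using D K by (simp add: c_def l_def power_divide power_mult_distrib) (simp add: field_simps power2_eq_square power4_eq_xxxx)
  finally show ?thesis .
qed

section \<open>The operator norm\<close>

text \<open>\<open>powr_convex\<close> is applied when both points are positive. If one of them is
  0, the claim reduces to \<open>c powr r \<le> c\<close> for a weight \<open>c\<close> between 0
  and 1.\<close>

lemma convex_on_powr_nonneg:
  assumes "(r::real) \<ge> 1"
  shows "convex_on {0..} (\<lambda>x. x powr r)"
proof (rule convex_onI)
  have scale: "(c * z) powr r \<le> c * z powr r" if "0 < c" "c < 1" for c z :: real
  proof -
    have "c powr r \<le> c powr 1" using that assms by (intro powr_mono') auto
    then show ?thesis using that by (simp add: powr_mult mult_right_mono)
  qed
  fix \<theta> x y :: real
  assume t: "0 < \<theta>" "\<theta> < 1" and xy: "x \<in> {0..}" "y \<in> {0..}"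
  consider "x = 0" | "y = 0" | "x > 0" "y > 0" using xy by fastforce
  then show "((1 - \<theta>) *\<^sub>R x + \<theta> *\<^sub>R y) powr r \<le> (1 - \<theta>) * x powr r + \<theta> * y powr r"
  proof cases
    case 1
    then show ?thesis using scale[of \<theta> y] t by simp
  next
    case 2
    then show ?thesis using scale[of "1 - \<theta>" x] t by simp
  next
    case 3
    then show ?thesis using convex_onD[OF powr_convex[OF assms], of \<theta> x y] t by simp
  qed
qed simp

section \<open>Minkowski's inequality and comparison of l_p norms with the Euclidean norm\<close>

lemma lp_norm_nonneg: "0 \<le> lp_norm p x"
  by (simp add: lp_norm_def infnorm_pos_le)

lemma lp_norm_finite_powr:
  fixes x :: "real ^ 'n"
  assumes "1 \<le> p" "p \<noteq> \<infinity>"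
  shows "lp_norm p x powr enn2real p = (\<Sum>i\<in>UNIV. \<bar>x $ i\<bar> powr enn2real p)"
  using enn2real_pos_of_ge_1[OF assms] assms by (simp add: lp_norm_def powr_powr sum_nonneg)

lemma lp_norm_eq_0D:
  fixes x :: "real ^ 'n"
  assumes "1 \<le> p" "lp_norm p x = 0"
  shows "x = 0"
proof (cases "p = \<infinity>")
  case True
  then show ?thesis using assms by (simp add: lp_norm_def infnorm_eq_0)
next
  case False
  have "(\<Sum>i\<in>UNIV. \<bar>x $ i\<bar> powr enn2real p) = 0"
    using lp_norm_finite_powr[OF assms(1) False, of x] assms(2) by simp
  then show ?thesis by (simp add: sum_nonneg_eq_0_iff vec_eq_iff)
qed

lemma one_le_enn2real:
  assumes "1 \<le> p" "p \<noteq> \<infinity>"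
  shows "1 \<le> enn2real p"
  using enn2real_mono[OF assms(1)] assms(2) by (simp add: less_top)

text \<open>Minkowski's inequality via convexity of the unit ball: dividing by \<open>a + b\<close>
  writes \<open>x + y\<close> as a convex combination of the unit vectors \<open>x / a\<close> and
  \<open>y / b\<close>, with weight \<open>\<theta>\<close> on the second, and the
  \<open>r\<close>-th power is convex. Vanishing norms are treated apart because of the
  divisions.\<close>

lemma lp_norm_triangle:
  fixes x y :: "real ^ 'n"
  assumes "1 \<le> p"
  shows "lp_norm p (x + y) \<le> lp_norm p x + lp_norm p y"
proof -
  define a where "a = lp_norm p x"
  define b where "b = lp_norm p y"
  consider "p = \<infinity>" | "a = 0" | "b = 0" | "p \<noteq> \<infinity>" "a > 0" "b > 0"
    using lp_norm_nonneg[of p] by (fastforce simp: a_def b_def less_le)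
  then show ?thesis
  proof cases
    case 1
    then show ?thesis by (simp add: lp_norm_def infnorm_triangle)
  next
    case 2
    then have "x = 0" using lp_norm_eq_0D[OF assms] by (simp add: a_def)
    then show ?thesis by (simp add: lp_norm_nonneg)
  next
    case 3
    then have "y = 0" using lp_norm_eq_0D[OF assms] by (simp add: b_def)
    then show ?thesis by (simp add: lp_norm_nonneg)
  next
    case 4
    define r where "r = enn2real p"
    have r: "1 \<le> r" unfolding r_def by (rule one_le_enn2real[OF assms 4(1)])
    define \<theta> where "\<theta> = b / (a + b)"
    have \<theta>: "0 \<le> \<theta>" "\<theta> \<le> 1" "(a + b) * (1 - \<theta>) = a" "(a + b) * \<theta> = b"
      using 4 by (auto simp: \<theta>_def field_simps)
    have "(\<Sum>i\<in>UNIV. \<bar>(x + y) $ i\<bar> powr r)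
        \<le> (\<Sum>i\<in>UNIV. (a + b) powr r * ((1 - \<theta>) * (\<bar>x $ i\<bar> powr r / a powr r) + \<theta> * (\<bar>y $ i\<bar> powr r / b powr r)))"
    proof (rule sum_mono)
      fix i
      have "\<bar>(x + y) $ i\<bar> \<le> ((a + b) * (1 - \<theta>)) * (\<bar>x $ i\<bar> / a) + ((a + b) * \<theta>) * (\<bar>y $ i\<bar> / b)"
        unfolding \<theta>(3,4) using 4 by simp
      also have "\<dots> = (a + b) * ((1 - \<theta>) * (\<bar>x $ i\<bar> / a) + \<theta> * (\<bar>y $ i\<bar> / b))"
        by (simp only: distrib_left mult.assoc)
      finally have "\<bar>(x + y) $ i\<bar> powr r \<le> ((a + b) * ((1 - \<theta>) * (\<bar>x $ i\<bar> / a) + \<theta> * (\<bar>y $ i\<bar> / b))) powr r"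
        using r by (intro powr_mono2) auto
      also have "\<dots> = (a + b) powr r * ((1 - \<theta>) * (\<bar>x $ i\<bar> / a) + \<theta> * (\<bar>y $ i\<bar> / b)) powr r"
        by (rule powr_mult)
      also have "\<dots> \<le> (a + b) powr r * ((1 - \<theta>) * (\<bar>x $ i\<bar> / a) powr r + \<theta> * (\<bar>y $ i\<bar> / b) powr r)"
        using convex_onD[OF convex_on_powr_nonneg[OF r] \<theta>(1,2), of "\<bar>x $ i\<bar> / a" "\<bar>y $ i\<bar> / b"] 4
        by (intro mult_left_mono) auto
      finally show "\<bar>(x + y) $ i\<bar> powr r
          \<le> (a + b) powr r * ((1 - \<theta>) * (\<bar>x $ i\<bar> powr r / a powr r) + \<theta> * (\<bar>y $ i\<bar> powr r / b powr r))"
        using 4 by (simp add: powr_divide)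
    qed
    also have "\<dots> = (a + b) powr r * ((1 - \<theta>) * ((\<Sum>i\<in>UNIV. \<bar>x $ i\<bar> powr r) / a powr r)
        + \<theta> * ((\<Sum>i\<in>UNIV. \<bar>y $ i\<bar> powr r) / b powr r))"
      by (simp add: sum.distrib flip: sum_distrib_left sum_divide_distrib)
    also have "\<dots> = (a + b) powr r"
    proof -
      have "(\<Sum>i\<in>UNIV. \<bar>x $ i\<bar> powr r) = a powr r" "(\<Sum>i\<in>UNIV. \<bar>y $ i\<bar> powr r) = b powr r"
        by (simp_all only: a_def b_def r_def lp_norm_finite_powr[OF assms 4(1)])
      then show ?thesis using 4 by simp
    qed
    finally have "lp_norm p (x + y) powr r \<le> (a + b) powr r"
      using lp_norm_finite_powr[OF assms 4(1), of "x + y"] by (simp add: r_def)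
    moreover have "(a + b) powr r < lp_norm p (x + y) powr r" if "a + b < lp_norm p (x + y)"
      using that r 4 by (intro powr_less_mono2) auto
    ultimately have "lp_norm p (x + y) \<le> a + b" by (meson not_less)
    then show ?thesis by (simp only: a_def b_def)
  qed
qed

text \<open>For \<open>p\<close> at least 2 or infinite, the l_p norm is at most the l2 norm and the
  dimension factor is at least 1. For \<open>p\<close> below 2 the power mean inequality costs the
  exponent \<open>1 / r - 1 / 2\<close>, and conjugacy turns \<open>1 - 2 / q\<close> into
  \<open>2 / r - 1\<close>.\<close>

lemma lp_norm_le_norm:
  fixes x :: "real ^ 'n"
  assumes "1 \<le> p" and q: "1 / p + 1 / q = 1"
  defines "s \<equiv> max 0 (1 - enn2real (2 / q))"
  shows "lp_norm p x \<le> real CARD('n) powr (s / 2) * norm x"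
proof -
  let ?m = "real CARD('n)"
  have m: "1 \<le> ?m" by (simp add: Suc_leI)
  have base: ?thesis if "lp_norm p x \<le> norm x"
  proof -
    have "1 \<le> ?m powr (s / 2)" by (rule ge_one_powr_ge_zero[OF m]) (simp add: s_def)
    then have "1 * norm x \<le> ?m powr (s / 2) * norm x" by (intro mult_right_mono) auto
    with that show ?thesis by simp
  qed
  define r where "r = enn2real p"
  consider "p = \<infinity>" | "p \<noteq> \<infinity>" "r \<ge> 2" | "p \<noteq> \<infinity>" "r < 2" by linarith
  then show ?thesis
  proof cases
    case 1
    then show ?thesis by (intro base) (simp add: lp_norm_def infnorm_le_norm)
  next
    case 2
    \<comment> \<open>Each coordinate is at most the norm, so \<open>r - 2\<close> of its
      \<open>r\<close> powers can be replaced by powers of the norm, leaving a sum of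
      squares.\<close>
    have "(\<Sum>i\<in>UNIV. \<bar>x $ i\<bar> powr r) \<le> (\<Sum>i\<in>UNIV. (x $ i)\<^sup>2 * norm x powr (r - 2))"
    proof (rule sum_mono)
      fix i
      have "\<bar>x $ i\<bar> powr r = \<bar>x $ i\<bar> powr 2 * \<bar>x $ i\<bar> powr (r - 2)"
        using powr_add[of "\<bar>x $ i\<bar>" 2 "r - 2"] by simp
      also have "\<dots> \<le> \<bar>x $ i\<bar> powr 2 * norm x powr (r - 2)"
        using 2 by (intro mult_left_mono powr_mono2 component_le_norm_cart) auto
      finally show "\<bar>x $ i\<bar> powr r \<le> (x $ i)\<^sup>2 * norm x powr (r - 2)" by simp
    qed
    also have "\<dots> = (norm x)\<^sup>2 * norm x powr (r - 2)"
      by (simp add: norm_vec_def L2_set_def sum_nonneg flip: sum_distrib_right)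
    also have "\<dots> = norm x powr r"
      using powr_add[of "norm x" 2 "r - 2"] by simp
    finally have "(\<Sum>i\<in>UNIV. \<bar>x $ i\<bar> powr r) powr (1 / r) \<le> (norm x powr r) powr (1 / r)"
      using 2 by (intro powr_mono2 sum_nonneg) auto
    then show ?thesis
      using 2 by (intro base) (simp add: lp_norm_def r_def powr_powr)
  next
    case 3
    have r: "1 \<le> r" unfolding r_def by (rule one_le_enn2real[OF assms(1) 3(1)])
    have p: "p = ennreal r" using 3 by (simp add: r_def less_top)
    have s: "1 / r - 1 / 2 \<le> s / 2"
    proof -
      \<comment> \<open>Both reciprocals are at most 1, hence finite, which lets the conjugacy
        relation pass from \<open>ennreal\<close> to the reals.\<close>
      have fin: "1 / q < top" "1 / p < top"
        using q by (metis add.commute ennreal_one_less_top le_iff_add le_less_trans)+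
      have "1 / p = ennreal (1 / r)"
        using r divide_ennreal[of 1 r] by (simp add: p)
      then have "enn2real (1 / p) = 1 / r" using r by simp
      moreover have "enn2real (1 / p) + enn2real (1 / q) = 1"
        using enn2real_plus[OF fin(2,1)] q by simp
      moreover have "enn2real (2 / q) = 2 * enn2real (1 / q)"
        using ennreal_times_divide[of 2 1 q] enn2real_mult[of 2 "1 / q"] by simp
      ultimately have "1 - enn2real (2 / q) = 2 / r - 1" by simp
      then show ?thesis by (simp add: s_def)
    qed
    let ?b = "\<Sum>i\<in>UNIV. \<bar>x $ i\<bar> powr r"
    \<comment> \<open>Jensen's inequality with uniform weights for the exponent \<open>2 / r\<close>
      applied to the numbers \<open>\<bar>x $ i\<bar> powr r\<close>; a square root then recovers
      the two norms.\<close>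
    have "1 \<le> 2 / r" using 3 r by simp
    from convex_on_sum[OF finite _ convex_on_powr_nonneg[OF this], of UNIV "\<lambda>_. 1 / ?m" "\<lambda>i. \<bar>x $ i\<bar> powr r"]
    have "(?b / ?m) powr (2 / r) \<le> (\<Sum>i\<in>UNIV. (\<bar>x $ i\<bar> powr r) powr (2 / r)) / ?m"
      by (simp add: sum_divide_distrib)
    also have "(\<Sum>i\<in>UNIV. (\<bar>x $ i\<bar> powr r) powr (2 / r)) = (norm x)\<^sup>2"
      using r by (simp add: powr_powr norm_vec_def L2_set_def sum_nonneg)
    finally have "((?b / ?m) powr (2 / r)) powr (1 / 2) \<le> ((norm x)\<^sup>2 / ?m) powr (1 / 2)"
      by (intro powr_mono2) auto
    then have "?b powr (1 / r) / ?m powr (1 / r) \<le> norm x / ?m powr (1 / 2)"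
      by (simp add: powr_powr powr_divide powr_half_sqrt)
    then have "?b powr (1 / r) \<le> ?m powr (1 / r) / ?m powr (1 / 2) * norm x"
      by (simp add: field_simps)
    also have "\<dots> = ?m powr (1 / r - 1 / 2) * norm x"
      by (simp add: powr_diff)
    also have "\<dots> \<le> ?m powr (s / 2) * norm x"
      using s m by (intro mult_right_mono powr_mono) auto
    finally show ?thesis using 3 by (simp add: lp_norm_def r_def)
  qed
qed

section \<open>Norm properties of the operator norm and its Frobenius bound\<close>

lemma op_norm_inf_bound:
  fixes B :: "real ^ 'n ^ 'm"
  assumes "1 \<le> p" "\<And>u. u \<noteq> 0 \<Longrightarrow> lp_norm p (B *v u) \<le> c * lp_norm \<infinity> u"
  shows "op_norm_inf p B \<le> c"
proof -
  obtain u where u: "u \<noteq> 0" "op_norm_inf p B = lp_norm p (B *v u) / lp_norm \<infinity> u"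
    using op_norm_inf_attained(1)[OF assms(1)] by blast
  have "lp_norm \<infinity> u > 0"
    using u(1) by (simp add: lp_norm_def infnorm_pos_lt)
  then show ?thesis using assms(2)[OF u(1)] u(2) by (simp add: divide_le_eq)
qed

text \<open>Together with \<open>op_norm_inf_bound\<close> this describes the operator norm as the
  least admissible constant, so the arguments below need not handle the supremum itself.\<close>

lemma lp_norm_le_op_norm_inf:
  fixes B :: "real ^ 'n ^ 'm"
  assumes "1 \<le> p" "u \<noteq> 0"
  shows "lp_norm p (B *v u) \<le> op_norm_inf p B * lp_norm \<infinity> u"
proof -
  have "lp_norm \<infinity> u > 0"
    using assms(2) by (simp add: lp_norm_def infnorm_pos_lt)
  then show ?thesis using op_norm_inf_attained(2)[OF assms, of B] by (simp add: divide_le_eq)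
qed

lemma op_norm_inf_triangle:
  fixes B C :: "real ^ 'n ^ 'm"
  assumes "1 \<le> p"
  shows "op_norm_inf p (B + C) \<le> op_norm_inf p B + op_norm_inf p C"
proof (rule op_norm_inf_bound[OF assms])
  fix u :: "real ^ 'n" assume u: "u \<noteq> 0"
  show "lp_norm p ((B + C) *v u) \<le> (op_norm_inf p B + op_norm_inf p C) * lp_norm \<infinity> u"
    using lp_norm_triangle[OF assms, of "B *v u" "C *v u"]
      lp_norm_le_op_norm_inf[OF assms u, of B] lp_norm_le_op_norm_inf[OF assms u, of C]
    by (simp add: matrix_vector_mult_add_rdistrib distrib_right)
qed

lemma op_norm_inf_scale_le:
  fixes B :: "real ^ 'n ^ 'm"
  assumes "1 \<le> p"
  shows "op_norm_inf p (c *\<^sub>R B) \<le> \<bar>c\<bar> * op_norm_inf p B"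
proof (rule op_norm_inf_bound[OF assms])
  fix u :: "real ^ 'n" assume u: "u \<noteq> 0"
  have "(c *\<^sub>R B) *v u = c *\<^sub>R (B *v u)"
    by (simp add: scaleR_matrix_vector_assoc)
  then show "lp_norm p ((c *\<^sub>R B) *v u) \<le> \<bar>c\<bar> * op_norm_inf p B * lp_norm \<infinity> u"
    using lp_norm_le_op_norm_inf[OF assms u, of B]
    by (simp add: lp_norm_scale[OF assms] mult.assoc mult_left_mono)
qed

text \<open>The norm of the nested vector type is the Frobenius norm, and Cauchy-Schwarz is applied
  to each row.\<close>

lemma norm_matrix_vector_mult_le:
  fixes B :: "real ^ 'n ^ 'm"
  shows "norm (B *v u) \<le> norm B * norm u"
proof -
  have "norm (B *v u) \<le> L2_set (\<lambda>j. norm (B $ j) * norm u) UNIV"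
    unfolding norm_vec_def[of "B *v u"]
    by (rule L2_set_mono) (auto simp: matrix_vector_mul_component Cauchy_Schwarz_ineq2)
  also have "\<dots> = norm B * norm u"
    by (simp add: norm_vec_def[of B] L2_set_left_distrib)
  finally show ?thesis .
qed

text \<open>The constant collects a factor \<open>sqrt (m powr s)\<close> from comparing l_p with l2
  on the output and a factor \<open>sqrt n\<close> from comparing l2 with the maximum norm on the
  input, where \<open>m\<close> and \<open>n\<close> are the numbers of rows and columns.\<close>

lemma op_norm_inf_le_norm:
  fixes B :: "real ^ 'n ^ 'm"
  assumes p: "1 \<le> p" and q: "1 / p + 1 / q = 1"
  defines "s \<equiv> max 0 (1 - enn2real (2 / q))"
  shows "op_norm_inf p B \<le> sqrt (real CARD('n) * real CARD('m) powr s) * norm B"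
proof (rule op_norm_inf_bound[OF p])
  fix u :: "real ^ 'n"
  let ?m = "real CARD('m)"
  have "lp_norm p (B *v u) \<le> ?m powr (s / 2) * norm (B *v u)"
    unfolding s_def by (rule lp_norm_le_norm[OF p q])
  also have "\<dots> \<le> ?m powr (s / 2) * (norm B * (sqrt (real CARD('n)) * infnorm u))"
    using norm_matrix_vector_mult_le[of B u] mult_left_mono[OF norm_le_infnorm[of u], of "norm B"]
    by (intro mult_left_mono) auto
  also have "?m powr (s / 2) = sqrt (?m powr s)"
    by (simp add: powr_powr flip: powr_half_sqrt)
  finally show "lp_norm p (B *v u)
      \<le> sqrt (real CARD('n) * real CARD('m) powr s) * norm B * lp_norm \<infinity> u"
    by (simp add: lp_norm_def real_sqrt_mult mult_ac)
qed

text \<open>Flattens the norm of rows of a matrix into one l2 norm indexed by pairs, the form in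
  which \<open>convex_concentration\<close> measures distance.\<close>

lemma norm_matrix_eq_L2_set:
  fixes B :: "real ^ 'n ^ 'm"
  shows "norm B = L2_set (\<lambda>i. B $ fst i $ snd i) UNIV"
  using sum.cartesian_product[of "\<lambda>j k. (B $ j $ k)\<^sup>2" UNIV UNIV]
  by (simp add: norm_vec_def L2_set_def sum_nonneg case_prod_beta)

section \<open>Concentration for a random matrix with independent bounded entries\<close>

theorem theorem2:
  fixes M :: "'w measure"
    and A :: "real ^ 'n ^ 'm"
    and X :: "'w \<Rightarrow> real ^ 'n ^ 'm"
    and p q :: ennreal
    and s D t :: real
  assumes "prob_space M"
    and "1 \<le> p"
    and "1 / p + 1 / q = 1"
    and "s = max 0 (1 - enn2real (2 / q))"
    and "prob_space.indep_vars M (\<lambda>_. borel) (\<lambda>(j, k) \<omega>. X \<omega> $ j $ k) UNIV"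
    and "entrywise_expectation M X = A"
    and "D > 0"
    and "\<And>j k. AE \<omega> in M. \<bar>X \<omega> $ j $ k\<bar> \<le> D / 2"
    and "t > 0"
  shows "measure M {\<omega> \<in> space M.
            op_norm_inf p (A - X \<omega>) > integral\<^sup>L M (\<lambda>\<omega>'. op_norm_inf p (A - X \<omega>')) + t}
          \<le> exp (- (t\<^sup>2 / (4 * D\<^sup>2 * real CARD('n) * real CARD('m) powr s)))"
proof -
  interpret prob_space M by fact
  let ?K = "sqrt (real CARD('n) * real CARD('m) powr s)"
  \<comment> \<open>Reshaping turns the entries into a single family indexed by pairs, so the
    deviation becomes a function \<open>f\<close> of independent real variables.\<close>
  define mat where "mat = (\<lambda>x :: 'm \<times> 'n \<Rightarrow> real. (\<chi> j k. x (j, k)) :: real ^ 'n ^ 'm)"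
  define f where "f = (\<lambda>x. op_norm_inf p (A - mat x))"
  have le: "f x - f y \<le> ?K * L2_set (\<lambda>i. x i - y i) UNIV" for x y
  proof -
    have "f x \<le> f y + op_norm_inf p (mat y - mat x)"
      using op_norm_inf_triangle[OF assms(2), of "A - mat y" "mat y - mat x"] by (simp add: f_def)
    also have "op_norm_inf p (mat y - mat x) \<le> ?K * norm (mat y - mat x)"
      unfolding assms(4) by (rule op_norm_inf_le_norm[OF assms(2,3)])
    also have "norm (mat y - mat x) = norm (mat x - mat y)"
      by (rule norm_minus_commute)
    also have "\<dots> = L2_set (\<lambda>i. x i - y i) UNIV"
      by (simp add: norm_matrix_eq_L2_set mat_def)
    finally show ?thesis by simp
  qed
  have lip: "\<bar>f x - f y\<bar> \<le> ?K * L2_set (\<lambda>i. x i - y i) UNIV" for x y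
    using le[of x y] le[of y x] by (simp add: abs_le_iff L2_set_def power2_commute)
  \<comment> \<open>The map from the entries to \<open>A - mat x\<close> is affine, and the operator
    norm is subadditive and absolutely homogeneous up to the inequality
    \<open>op_norm_inf_scale_le\<close>.\<close>
  have cv: "convex_fun f"
    unfolding convex_fun_def
  proof (intro allI impI)
    fix x y and \<theta> :: real assume t: "0 \<le> \<theta>" "\<theta> \<le> 1"
    have "A - mat (\<lambda>i. (1 - \<theta>) * x i + \<theta> * y i) = (1 - \<theta>) *\<^sub>R (A - mat x) + \<theta> *\<^sub>R (A - mat y)"
      by (simp add: mat_def vec_eq_iff algebra_simps)
    then have "f (\<lambda>i. (1 - \<theta>) * x i + \<theta> * y i)
        \<le> op_norm_inf p ((1 - \<theta>) *\<^sub>R (A - mat x)) + op_norm_inf p (\<theta> *\<^sub>R (A - mat y))"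
      unfolding f_def by (simp only: op_norm_inf_triangle[OF assms(2)])
    also have "\<dots> \<le> (1 - \<theta>) * f x + \<theta> * f y"
      using op_norm_inf_scale_le[OF assms(2), of "1 - \<theta>" "A - mat x"]
        op_norm_inf_scale_le[OF assms(2), of \<theta> "A - mat y"] t
      by (simp add: f_def)
    finally show "f (\<lambda>i. (1 - \<theta>) * x i + \<theta> * y i) \<le> (1 - \<theta>) * f x + \<theta> * f y" .
  qed
  let ?X = "\<lambda>(j, k) \<omega>. X \<omega> $ j $ k"
  have fX: "f (\<lambda>i. ?X i \<omega>) = op_norm_inf p (A - X \<omega>)" for \<omega>
    by (simp add: f_def mat_def)
  have "AE \<omega> in M. \<bar>?X i \<omega>\<bar> \<le> D / 2" for i
    using assms(8)[of "fst i" "snd i"] by (simp add: case_prod_beta)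
  moreover have "?K > 0" by simp
  ultimately have "prob {\<omega> \<in> space M. f (\<lambda>i. ?X i \<omega>) > expectation (\<lambda>\<omega>. f (\<lambda>i. ?X i \<omega>)) + t}
      \<le> exp (- (t\<^sup>2 / (4 * D\<^sup>2 * ?K\<^sup>2)))"
    by (intro convex_concentration[OF assms(5) _ lip cv assms(7) _ assms(9)])
  then show ?thesis
    unfolding fX by (simp add: mult.assoc)
qed

end
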